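(* Let $r>0$, let $a,b\ge -1$ be real, and let $n,m>1$ be integers. Let $R=R^{(r,a,b)}_{m,n}=B_m\circ\mathcal{B}^{a,b}_r\circ B_n : C[0,1]\to C[0,1]$ be the Bernstein-Euler-Jacobi operator of type I, and put $T(f,g;x):=R(fg;x)-R(f;x)\,R(g;x)$. Then for all $f,g\in C[0,1]$ and every fixed $x\in[0,1]$, $$|T(f,g;x)|\le \frac14\,\widetilde{\omega}\left(f;2\sqrt{R^{(r,a,b)}_{m,n}((e_1-x)^2;x)}\right)\cdot\widetilde{\omega}\left(g;2\sqrt{R^{(r,a,b)}_{m,n}((e_1-x)^2;x)}\right).$$
   Context: All functions are real-valued. For an operator $H:C[0,1]\to C[0,1]$ write $H(f;x):=(Hf)(x)$. Let $e_i(t)=t^i$ for $i\ge 0$; thus $H((e_1-x)^2;x)$ denotes $H$ applied to the function $t\mapsto (t-x)^2$ (with $x$ fixed) and evaluated at the point $x$. Bernstein operator: for an integer $n\ge1$, $B_n(f;x)=\sum_{k=0}^n f(k/n)\binom{n}{k}x^k(1-x)^{n-k}$. Euler-Jacobi Beta operator: for $r>0$, $a,b\ge-1$, $f\in C[0,1]$ and $x\in[0,1]$, $$\mathcal{B}^{a,b}_r(f;x)=\frac{\int_0^1 t^{rx+a}(1-t)^{r(1-x)+b}f(t)\,dt}{\int_0^1 t^{rx+a}(1-t)^{r(1-x)+b}\,dt},$$ except that if $a=-1$ then $\mathcal{B}^{a,b}_r(f;0):=f(0)$, and if $b=-1$ then $\mathcal{B}^{a,b}_r(f;1):=f(1)$.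 Composition is read as $(B_m\circ\mathcal{B}^{a,b}_r\circ B_n)f=B_m(\mathcal{B}^{a,b}_r(B_nf))$. Modulus of continuity: $\omega(f;t)=\sup\{|f(u)-f(v)|: u,v\in[0,1],\ |u-v|\le t\}$ for $t\ge0$. Its least concave majorant $\widetilde\omega(f;\cdot)$ is the smallest concave function on $[0,\infty)$ that is $\ge\omega(f;\cdot)$; equivalently $\widetilde\omega(f;t)=\sup_{0\le u\le t\le v\le 1,\,u\ne v}\frac{(t-u)\omega(f;v)+(v-t)\omega(f;u)}{v-u}$ for $0\le t\le1$ and $\widetilde\omega(f;t)=\omega(f;1)$ for $t>1$. *)

theory Defs
  imports "HOL-Analysis.Analysis"
begin

text \<open>
  Elements of \<open>C[0,1]\<close> are functions of type \<open>real \<Rightarrow> real\<close> that are continuous on \<open>{0..1}\<close>.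
  All operators below depend only on the restriction of their argument to \<open>{0..1}\<close>.
\<close>

definition bernstein_op :: "nat \<Rightarrow> (real \<Rightarrow> real) \<Rightarrow> real \<Rightarrow> real" where
  "bernstein_op n f x = (\<Sum>k\<le>n. f (real k / real n) * Bernstein n k x)"

text \<open>
  For \<open>x \<in> {0..1}\<close> outside the two exceptional cases both exponents exceed \<open>-1\<close>, so the integrals
  exist (as Lebesgue integrals too) when \<open>f\<close> is continuous on \<open>{0..1}\<close>.
\<close>

definition beta_op :: "real \<Rightarrow> real \<Rightarrow> real \<Rightarrow> (real \<Rightarrow> real) \<Rightarrow> real \<Rightarrow> real" where
  "beta_op r a b f x =
     (if a = -1 \<and> x = 0 then f 0
      else if b = -1 \<and> x = 1 then f 1
      else integral {0..1} (\<lambda>t. t powr (r * x + a) * (1 - t) powr (r * (1 - x) + b) * f t)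
         / integral {0..1} (\<lambda>t. t powr (r * x + a) * (1 - t) powr (r * (1 - x) + b)))"

definition bernstein_euler_jacobi ::
    "nat \<Rightarrow> nat \<Rightarrow> real \<Rightarrow> real \<Rightarrow> real \<Rightarrow> (real \<Rightarrow> real) \<Rightarrow> real \<Rightarrow> real" where
  "bernstein_euler_jacobi m n r a b = bernstein_op m \<circ> beta_op r a b \<circ> bernstein_op n"

definition chebyshev_functional ::
    "((real \<Rightarrow> real) \<Rightarrow> real \<Rightarrow> real) \<Rightarrow> (real \<Rightarrow> real) \<Rightarrow> (real \<Rightarrow> real) \<Rightarrow> real \<Rightarrow> real" where
  "chebyshev_functional H f g x = H (\<lambda>t. f t * g t) x - H f x * H g x"

definition modulus_cont :: "(real \<Rightarrow> real) \<Rightarrow> real \<Rightarrow> real" where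
  "modulus_cont f t =
     Sup {\<bar>f u - f v\<bar> | u v. u \<in> {0..1} \<and> v \<in> {0..1} \<and> \<bar>u - v\<bar> \<le> t}"

definition concave_majorant :: "(real \<Rightarrow> real) \<Rightarrow> (real \<Rightarrow> real) \<Rightarrow> bool" where
  "concave_majorant w h \<longleftrightarrow> concave_on {0..} h \<and> (\<forall>s\<ge>0. w s \<le> h s)"

text \<open>
  The least concave majorant on \<open>{0..}\<close>, as the pointwise infimum of all concave majorants. The
  lemmas below show that, for \<open>w = modulus_cont f\<close> with \<open>f\<close> continuous, this infimum is itself a
  concave majorant, hence the smallest one.
\<close>

definition least_concave_majorant :: "(real \<Rightarrow> real) \<Rightarrow> real \<Rightarrow> real" where
  "least_concave_majorant w t = (INF h\<in>{h. concave_majorant w h}. h t)"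

lemma least_concave_majorant_le:
  assumes "concave_majorant w h" and "t \<ge> 0"
  shows "least_concave_majorant w t \<le> h t"
  unfolding least_concave_majorant_def
proof (rule cINF_lower)
  show "bdd_below ((\<lambda>h. h t) ` {h. concave_majorant w h})"
    using assms(2) by (intro bdd_belowI2[where m = "w t"]) (auto simp: concave_majorant_def)
qed (use assms in auto)

lemma concave_majorant_least:
  assumes ex: "concave_majorant w h0"
  shows "concave_majorant w (least_concave_majorant w)"
proof -
  let ?L = "least_concave_majorant w"
  have ne: "{h. concave_majorant w h} \<noteq> {}" using ex by blast
  have "w s \<le> ?L s" if "s \<ge> 0" for s
    unfolding least_concave_majorant_def using that
    by (intro cINF_greatest ne) (auto simp: concave_majorant_def)
  moreover have "concave_on {0..} ?L"
    unfolding concave_on_iff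
  proof (intro conjI ballI allI impI)
    fix x y u v :: real
    assume xy: "x \<in> {0..}" "y \<in> {0..}" and uv: "0 \<le> u" "0 \<le> v" "u + v = 1"
    have "u * ?L x + v * ?L y \<le> h (u *\<^sub>R x + v *\<^sub>R y)"
      if h: "concave_majorant w h" for h
    proof -
      have "u * ?L x + v * ?L y \<le> u * h x + v * h y"
        using least_concave_majorant_le[OF h] xy uv by (intro add_mono mult_left_mono) auto
      also have "\<dots> \<le> h (u *\<^sub>R x + v *\<^sub>R y)"
        using h xy uv unfolding concave_majorant_def concave_on_iff by blast
      finally show ?thesis .
    qed
    then show "u * ?L x + v * ?L y \<le> ?L (u *\<^sub>R x + v *\<^sub>R y)"
      unfolding least_concave_majorant_def[of w "u *\<^sub>R x + v *\<^sub>R y"] using ne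
      by (intro cINF_greatest) auto
  qed auto
  ultimately show ?thesis by (auto simp: concave_majorant_def)
qed

lemma ex_concave_majorant_modulus_cont:
  assumes "continuous_on {0..1} f"
  shows "\<exists>h. concave_majorant (modulus_cont f) h"
proof -
  have "bounded (f ` {0..1})"
    using assms by (intro compact_imp_bounded compact_continuous_image) auto
  then obtain B where B: "\<And>u. u \<in> {0..1} \<Longrightarrow> \<bar>f u\<bar> \<le> B"
    unfolding bounded_iff by (metis imageI real_norm_def)
  have "modulus_cont f s \<le> 2 * B" if "s \<ge> 0" for s
    unfolding modulus_cont_def
  proof (rule cSup_least)
    show "{\<bar>f u - f v\<bar> | u v. u \<in> {0..1} \<and> v \<in> {0..1} \<and> \<bar>u - v\<bar> \<le> s} \<noteq> {}"
      using that by (auto intro!: exI[of _ "0::real"])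
  next
    fix y assume "y \<in> {\<bar>f u - f v\<bar> | u v. u \<in> {0..1} \<and> v \<in> {0..1} \<and> \<bar>u - v\<bar> \<le> s}"
    then obtain u v where "u \<in> {0..1}" "v \<in> {0..1}" "y = \<bar>f u - f v\<bar>" by blast
    then show "y \<le> 2 * B" using B[of u] B[of v] by linarith
  qed
  then have "concave_majorant (modulus_cont f) (\<lambda>_. 2 * B)"
    by (auto simp: concave_majorant_def concave_on_iff simp flip: distrib_right)
  then show ?thesis by blast
qed

lemma concave_majorant_modulus_cont:
  assumes "continuous_on {0..1} f"
  shows "concave_majorant (modulus_cont f) (least_concave_majorant (modulus_cont f))"
  using ex_concave_majorant_modulus_cont[OF assms] concave_majorant_least by blast

definition concave_modulus :: "(real \<Rightarrow> real) \<Rightarrow> real \<Rightarrow> real" where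
  "concave_modulus f = least_concave_majorant (modulus_cont f)"

end

theory Submission
  imports Defs
begin

text \<open>
  For fixed \<open>x\<close> the map \<open>f \<mapsto> R f x\<close> is a positive linear functional on \<open>C[0,1]\<close> with value \<open>1\<close>
  at the constant \<open>1\<close>, that is, an expectation, and the inequality holds for every such functional
  \<open>A\<close>. The Chebyshev functional is the covariance of \<open>f\<close> and
  \<open>g\<close> under this expectation, so the Cauchy-Schwarz inequality reduces the claim to the variance
  bound \<open>Var f \<le> (h (2 \<sigma>) / 2)\<^sup>2\<close>, where \<open>h\<close> is the concave majorant and
  \<open>\<sigma>\<^sup>2 = A (\<lambda>t. (t - x)\<^sup>2)\<close>.

  For the variance bound with \<open>\<sigma> > 0\<close>, let \<open>s \<mapsto> c + L s\<close> be a line supporting the graph of \<open>h\<close>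
  from above at \<open>s = 2 \<sigma>\<close>. Then \<open>\<bar>f u - f v\<bar> \<le> c + L \<bar>u - v\<bar>\<close>, and this forces \<open>f\<close> to lie within
  \<open>c / 2\<close> of an \<open>L\<close>-Lipschitz function \<open>p\<close>. Since the standard deviation is a seminorm, that of \<open>f\<close>
  is at most that of \<open>f - p\<close>, which is bounded by \<open>c / 2\<close>, plus that of \<open>p\<close>, which is bounded by
  \<open>L \<sigma>\<close>. The sum is \<open>c / 2 + L \<sigma> = h (2 \<sigma>) / 2\<close>. When \<open>\<sigma> = 0\<close> there need not be a supporting
  line at \<open>0\<close>, but then the expectation is evaluation at \<open>x\<close> and all variances vanish.
\<close>

section \<open>Lipschitz approximation and supporting lines\<close>

text \<open>
  The infimal convolution of \<open>f\<close> with \<open>L * dist\<close> is \<open>L\<close>-Lipschitz and lies between \<open>f - c\<close> and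
  \<open>f\<close>; adding \<open>c / 2\<close> centres it.
\<close>
lemma almost_Lipschitz_approximation:
  fixes f :: "'a::metric_space \<Rightarrow> real"
  assumes L: "L \<ge> 0"
    and f: "\<And>u v. u \<in> S \<Longrightarrow> v \<in> S \<Longrightarrow> f u - f v \<le> c + L * dist u v"
  obtains p where "L-lipschitz_on S p" and "\<And>u. u \<in> S \<Longrightarrow> \<bar>f u - p u\<bar> \<le> c / 2"
proof -
  define q where "q u = (INF v\<in>S. f v + L * dist u v)" for u
  have bdd: "bdd_below ((\<lambda>v. f v + L * dist u v) ` S)" if "u \<in> S" for u
    using f[OF that] by (intro bdd_belowI2[where m = "f u - c"]) (auto simp: algebra_simps)
  have le: "q u \<le> f v + L * dist u v" if "u \<in> S" "v \<in> S" for u v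
    unfolding q_def using bdd[OF that(1)] that(2) by (rule cINF_lower)
  have Lip: "q u - q v \<le> L * dist u v" if uv: "u \<in> S" "v \<in> S" for u v
  proof -
    have "q u - L * dist u v \<le> f w + L * dist v w" if "w \<in> S" for w
    proof -
      have "L * dist u w \<le> L * (dist u v + dist v w)"
        using L by (intro mult_left_mono dist_triangle)
      then show ?thesis using le[OF uv(1) that] by (simp add: algebra_simps)
    qed
    then have "q u - L * dist u v \<le> q v"
      unfolding q_def[of v] using uv by (intro cINF_greatest) auto
    then show ?thesis by simp
  qed
  show thesis
  proof
    show "L-lipschitz_on S (\<lambda>u. q u + c / 2)"
    proof (rule lipschitz_onI)
      fix u v assume "u \<in> S" "v \<in> S"
      then show "dist (q u + c / 2) (q v + c / 2) \<le> L * dist u v"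
        using Lip[of u v] Lip[of v u] by (simp add: dist_real_def dist_commute abs_le_iff)
    qed (fact L)
    show "\<bar>f u - (q u + c / 2)\<bar> \<le> c / 2" if u: "u \<in> S" for u
    proof -
      have "f u - c \<le> q u"
        unfolding q_def using u f[OF u] by (intro cINF_greatest) (auto simp: algebra_simps)
      moreover have "q u \<le> f u" using le[OF u u] by simp
      ultimately show ?thesis by linarith
    qed
  qed
qed

lemma concave_on_supporting_line:
  fixes h :: "real \<Rightarrow> real"
  assumes "concave_on I h" and "s \<in> interior I"
  obtains L where "\<And>y. y \<in> I \<Longrightarrow> h y \<le> h s + L * (y - s)"
proof -
  have "convex_on I (\<lambda>y. - h y)" using assms(1) by (simp add: concave_on_def)
  from convex_le_Inf_differential[OF this assms(2)]
  obtain K where K: "\<And>y. y \<in> I \<Longrightarrow> - h s + K * (y - s) \<le> - h y" by blast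
  show thesis
  proof
    show "h y \<le> h s + (- K) * (y - s)" if "y \<in> I" for y
      using K[OF that] by simp
  qed
qed

lemma bounded_below_supporting_slope_nonneg:
  fixes h :: "real \<Rightarrow> real"
  assumes "\<And>y. y \<ge> 0 \<Longrightarrow> 0 \<le> h y" and "\<And>y. y \<ge> 0 \<Longrightarrow> h y \<le> d + L * (y - s)"
  shows "L \<ge> 0"
proof (rule ccontr)
  assume "\<not> L \<ge> 0"
  then have L: "L < 0" by simp
  define y where "y = max 0 (s + (d + 1) / (- L))"
  have "(d + 1) / (- L) \<le> y - s" by (simp add: y_def)
  then have "d + 1 \<le> (y - s) * (- L)" using L by (simp only: pos_divide_le_eq)
  moreover have "y \<ge> 0" by (simp add: y_def)
  then have "0 \<le> d + L * (y - s)" using assms[of y] by linarith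
  ultimately show False by (simp add: algebra_simps)
qed

section \<open>The modulus of continuity\<close>

lemma modulus_cont_ge:
  assumes f: "continuous_on {0..1} f" and uv: "u \<in> {0..1}" "v \<in> {0..1}" "\<bar>u - v\<bar> \<le> s"
  shows "\<bar>f u - f v\<bar> \<le> modulus_cont f s"
proof -
  have "bounded (f ` {0..1})"
    using f by (intro compact_imp_bounded compact_continuous_image) auto
  then obtain B where B: "\<And>u. u \<in> {0..1} \<Longrightarrow> \<bar>f u\<bar> \<le> B"
    unfolding bounded_iff by (metis imageI real_norm_def)
  have "bdd_above {\<bar>f u' - f v'\<bar> | u' v'. u' \<in> {0..1} \<and> v' \<in> {0..1} \<and> \<bar>u' - v'\<bar> \<le> s}"
  proof (rule bdd_aboveI)
    fix y
    assume "y \<in> {\<bar>f u' - f v'\<bar> | u' v'. u' \<in> {0..1} \<and> v' \<in> {0..1} \<and> \<bar>u' - v'\<bar> \<le> s}"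
    then obtain u' v' where "u' \<in> {0..1}" "v' \<in> {0..1}" "y = \<bar>f u' - f v'\<bar>" by blast
    then show "y \<le> 2 * B" using B[of u'] B[of v'] by linarith
  qed
  then show ?thesis
    unfolding modulus_cont_def using uv by (intro cSup_upper) auto
qed

lemma concave_majorant_modulus_nonneg:
  assumes "continuous_on {0..1} f" and "concave_majorant (modulus_cont f) h" and "s \<ge> 0"
  shows "0 \<le> h s"
proof -
  have "0 \<le> modulus_cont f s" using modulus_cont_ge[OF assms(1), of 0 0 s] assms(3) by simp
  also have "\<dots> \<le> h s" using assms(2,3) by (simp add: concave_majorant_def)
  finally show ?thesis .
qed

text \<open>
  Half the value of a concave majorant at \<open>2 s\<close> is an upper bound for the \<open>K\<close>-functional of the
  pair (continuous, Lipschitz) at \<open>s\<close>. The supporting line at \<open>2 s\<close> supplies both the Lipschitz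
  constant and the distance.
\<close>
lemma concave_majorant_Lipschitz_approximation:
  assumes f: "continuous_on {0..1} f" and h: "concave_majorant (modulus_cont f) h" and s: "s > 0"
  obtains p c L where "L-lipschitz_on {0..1} p" and "\<And>u. u \<in> {0..1} \<Longrightarrow> \<bar>f u - p u\<bar> \<le> c"
    and "c + L * s = h (2 * s) / 2"
proof -
  have "concave_on {0..} h" using h by (simp add: concave_majorant_def)
  moreover have "2 * s \<in> interior {0..}" using s by simp
  ultimately obtain L where L: "\<And>y. y \<in> {0..} \<Longrightarrow> h y \<le> h (2 * s) + L * (y - 2 * s)"
    using concave_on_supporting_line by blast
  have "L \<ge> 0"
    by (rule bounded_below_supporting_slope_nonneg[of h "h (2 * s)" L "2 * s"])
      (use concave_majorant_modulus_nonneg[OF f h] L in auto)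
  define c where "c = h (2 * s) - L * (2 * s)"
  have "f u - f v \<le> c + L * dist u v" if "u \<in> {0..1}" "v \<in> {0..1}" for u v
  proof -
    have "f u - f v \<le> modulus_cont f \<bar>u - v\<bar>"
      using modulus_cont_ge[OF f that order_refl] by linarith
    also have "\<dots> \<le> h \<bar>u - v\<bar>" using h by (simp add: concave_majorant_def)
    also have "\<dots> \<le> c + L * dist u v"
      using L[of "\<bar>u - v\<bar>"] by (simp add: c_def dist_real_def algebra_simps)
    finally show ?thesis .
  qed
  from almost_Lipschitz_approximation[OF \<open>L \<ge> 0\<close> this]
  obtain p where "L-lipschitz_on {0..1} p" "\<And>u. u \<in> {0..1} \<Longrightarrow> \<bar>f u - p u\<bar> \<le> c / 2"
    by blast
  moreover have "c / 2 + L * s = h (2 * s) / 2" by (simp add: c_def diff_divide_distrib)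
  ultimately show thesis by (rule that)
qed

section \<open>Covariance under a positive normalized functional\<close>

locale unital_positive_functional =
  fixes A :: "(real \<Rightarrow> real) \<Rightarrow> real"
  assumes add: "continuous_on {0..1} f \<Longrightarrow> continuous_on {0..1} g \<Longrightarrow>
      A (\<lambda>t. f t + g t) = A f + A g"
    and scale: "continuous_on {0..1} f \<Longrightarrow> A (\<lambda>t. c * f t) = c * A f"
    and nonneg: "continuous_on {0..1} f \<Longrightarrow> (\<And>t. t \<in> {0..1} \<Longrightarrow> 0 \<le> f t) \<Longrightarrow> 0 \<le> A f"
    and one: "A (\<lambda>_. 1) = 1"
begin

lemma lincomb:
  assumes "continuous_on {0..1} f" and "continuous_on {0..1} g"
  shows "A (\<lambda>t. c * f t + d * g t) = c * A f + d * A g"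
  using assms by (simp add: add scale continuous_intros)

lemma const: "A (\<lambda>_. c) = c"
  using scale[of "\<lambda>_. 1" c] by (simp add: one)

lemma mono:
  assumes f: "continuous_on {0..1} f" and g: "continuous_on {0..1} g"
    and "\<And>t. t \<in> {0..1} \<Longrightarrow> f t \<le> g t"
  shows "A f \<le> A g"
proof -
  have "0 \<le> A (\<lambda>t. 1 * g t + (-1) * f t)"
    using assms by (intro nonneg continuous_intros) auto
  then show ?thesis unfolding lincomb[OF g f] by simp
qed

definition cov :: "(real \<Rightarrow> real) \<Rightarrow> (real \<Rightarrow> real) \<Rightarrow> real" where
  "cov f g = A (\<lambda>t. f t * g t) - A f * A g"

lemma second_moment_about:
  assumes f: "continuous_on {0..1} f"
  shows "A (\<lambda>t. (f t - d)\<^sup>2) = cov f f + (A f - d)\<^sup>2"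
proof -
  have "(\<lambda>t. (f t - d)\<^sup>2) = (\<lambda>t. 1 * (f t * f t) + 1 * ((-2 * d) * f t + d\<^sup>2 * 1))"
    by (simp add: fun_eq_iff power2_eq_square algebra_simps)
  then have "A (\<lambda>t. (f t - d)\<^sup>2) = A (\<lambda>t. 1 * (f t * f t) + 1 * ((-2 * d) * f t + d\<^sup>2 * 1))"
    by simp
  also have "\<dots> = 1 * A (\<lambda>t. f t * f t) + 1 * A (\<lambda>t. (-2 * d) * f t + d\<^sup>2 * 1)"
    by (rule lincomb) (intro continuous_intros f)+
  also have "A (\<lambda>t. (-2 * d) * f t + d\<^sup>2 * 1) = (-2 * d) * A f + d\<^sup>2 * A (\<lambda>_. 1)"
    by (rule lincomb) (intro continuous_intros f)+
  finally show ?thesis by (simp add: cov_def one power2_eq_square algebra_simps)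
qed

lemma second_moment_nonneg: "0 \<le> A (\<lambda>t. (t - x)\<^sup>2)"
  by (rule nonneg) (auto intro!: continuous_intros)

lemma cov_self_nonneg:
  assumes f: "continuous_on {0..1} f"
  shows "0 \<le> cov f f"
proof -
  have "0 \<le> A (\<lambda>t. (f t - A f)\<^sup>2)" using f by (intro nonneg continuous_intros) auto
  then show ?thesis by (simp add: second_moment_about[OF f])
qed

lemma cov_self_le:
  assumes "continuous_on {0..1} f"
  shows "cov f f \<le> A (\<lambda>t. (f t - d)\<^sup>2)"
  by (simp add: second_moment_about[OF assms])

lemma cov_self_lincomb:
  assumes f: "continuous_on {0..1} f" and g: "continuous_on {0..1} g"
  shows "cov (\<lambda>t. f t + c * g t) (\<lambda>t. f t + c * g t) = cov f f + 2 * c * cov f g + c\<^sup>2 * cov g g"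
proof -
  let ?q = "\<lambda>t. (2 * c) * (f t * g t) + c\<^sup>2 * (g t * g t)"
  have "(\<lambda>t. (f t + c * g t) * (f t + c * g t)) = (\<lambda>t. 1 * (f t * f t) + 1 * ?q t)"
    by (simp add: fun_eq_iff power2_eq_square algebra_simps)
  then have "A (\<lambda>t. (f t + c * g t) * (f t + c * g t)) = A (\<lambda>t. 1 * (f t * f t) + 1 * ?q t)"
    by simp
  also have "\<dots> = 1 * A (\<lambda>t. f t * f t) + 1 * A ?q"
    by (rule lincomb) (intro continuous_intros f g)+
  also have "A ?q = (2 * c) * A (\<lambda>t. f t * g t) + c\<^sup>2 * A (\<lambda>t. g t * g t)"
    by (rule lincomb) (intro continuous_intros f g)+
  finally show ?thesis
    using lincomb[OF f g, of 1 c] by (simp add: cov_def power2_eq_square algebra_simps)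
qed

lemma cov_Cauchy_Schwarz:
  assumes f: "continuous_on {0..1} f" and g: "continuous_on {0..1} g"
  shows "(cov f g)\<^sup>2 \<le> cov f f * cov g g"
proof -
  have quad: "0 \<le> cov f f + 2 * c * cov f g + c\<^sup>2 * cov g g" for c
    using cov_self_nonneg[of "\<lambda>t. f t + c * g t"] f g
    by (simp add: cov_self_lincomb continuous_intros)
  show ?thesis
  proof (cases "cov g g = 0")
    case True
    have "cov f g = 0"
    proof (rule ccontr)
      assume "cov f g \<noteq> 0"
      with quad[of "- (cov f f + 1) / (2 * cov f g)"] True show False
        by (simp add: field_simps)
    qed
    with True show ?thesis by simp
  next
    case False
    with cov_self_nonneg[OF g] have "cov g g > 0" by simp
    with quad[of "- cov f g / cov g g"] show ?thesis
      by (simp add: field_simps power2_eq_square)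
  qed
qed

lemma abs_cov_le:
  assumes f: "continuous_on {0..1} f" and g: "continuous_on {0..1} g"
    and "cov f f \<le> P\<^sup>2" and "cov g g \<le> Q\<^sup>2" and "0 \<le> P" and "0 \<le> Q"
  shows "\<bar>cov f g\<bar> \<le> P * Q"
proof -
  have "(cov f g)\<^sup>2 \<le> cov f f * cov g g" by (rule cov_Cauchy_Schwarz[OF f g])
  also have "\<dots> \<le> P\<^sup>2 * Q\<^sup>2"
    using assms(3,4) cov_self_nonneg[OF g] by (intro mult_mono) auto
  finally have "\<bar>cov f g\<bar>\<^sup>2 \<le> (P * Q)\<^sup>2" by (simp add: power_mult_distrib)
  then show ?thesis using assms(5,6) by (simp add: power2_le_iff_abs_le)
qed

text \<open>The triangle inequality for the standard deviation.\<close>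
lemma cov_self_add_le:
  assumes f: "continuous_on {0..1} f" and g: "continuous_on {0..1} g"
    and P: "cov f f \<le> P\<^sup>2" "0 \<le> P" and Q: "cov g g \<le> Q\<^sup>2" "0 \<le> Q"
  shows "cov (\<lambda>t. f t + g t) (\<lambda>t. f t + g t) \<le> (P + Q)\<^sup>2"
proof -
  have "cov f g \<le> P * Q"
    using abs_cov_le[OF f g P(1) Q(1) P(2) Q(2)] by simp
  then show ?thesis
    using cov_self_lincomb[OF f g, of 1] P(1) Q(1) by (simp add: power2_sum)
qed

lemma cov_self_le_of_bounded:
  assumes f: "continuous_on {0..1} f" and bd: "\<And>t. t \<in> {0..1} \<Longrightarrow> \<bar>f t\<bar> \<le> c"
  shows "cov f f \<le> c\<^sup>2"
proof -
  have "cov f f \<le> A (\<lambda>t. (f t - 0)\<^sup>2)" by (rule cov_self_le[OF f])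
  also have "\<dots> \<le> A (\<lambda>_. c\<^sup>2)"
  proof (rule mono)
    show "(f t - 0)\<^sup>2 \<le> c\<^sup>2" if "t \<in> {0..1}" for t
      using power_mono[OF bd[OF that], of 2] by simp
  qed (intro continuous_intros f)+
  finally show ?thesis by (simp add: const)
qed

lemma cov_self_le_of_lipschitz:
  assumes p: "L-lipschitz_on {0..1} p" and x: "x \<in> {0..1}"
  shows "cov p p \<le> L\<^sup>2 * A (\<lambda>t. (t - x)\<^sup>2)"
proof -
  have cont: "continuous_on {0..1} p" by (rule lipschitz_on_continuous_on[OF p])
  have "cov p p \<le> A (\<lambda>t. (p t - p x)\<^sup>2)" by (rule cov_self_le[OF cont])
  also have "\<dots> \<le> A (\<lambda>t. L\<^sup>2 * (t - x)\<^sup>2)"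
  proof (rule mono)
    show "(p t - p x)\<^sup>2 \<le> L\<^sup>2 * (t - x)\<^sup>2" if "t \<in> {0..1}" for t
    proof -
      have "\<bar>p t - p x\<bar> \<le> L * \<bar>t - x\<bar>"
        using lipschitz_onD[OF p that x] by (simp add: dist_real_def)
      then have "\<bar>p t - p x\<bar>\<^sup>2 \<le> (L * \<bar>t - x\<bar>)\<^sup>2" by (rule power_mono) simp
      then show ?thesis by (simp add: power_mult_distrib)
    qed
  qed (intro continuous_intros cont)+
  finally show ?thesis by (simp add: scale continuous_intros)
qed

text \<open>
  As in Korovkin's theorem, \<open>(f t - f x)\<^sup>2\<close> is dominated by a small constant plus a multiple of
  \<open>(t - x)\<^sup>2\<close>.
\<close>
lemma cov_self_eq_0:
  assumes f: "continuous_on {0..1} f" and x: "x \<in> {0..1}" and zero: "A (\<lambda>t. (t - x)\<^sup>2) = 0"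
  shows "cov f f = 0"
proof -
  have "bounded (f ` {0..1})"
    using f by (intro compact_imp_bounded compact_continuous_image) auto
  then obtain B where B: "\<And>u. u \<in> {0..1} \<Longrightarrow> \<bar>f u\<bar> \<le> B"
    unfolding bounded_iff by (metis imageI real_norm_def)
  have "cov f f \<le> e" if e: "e > 0" for e
  proof -
    from f x e obtain \<delta> where \<delta>: "\<delta> > 0"
      and near: "\<And>t. t \<in> {0..1} \<Longrightarrow> dist t x < \<delta> \<Longrightarrow> dist (f t) (f x) < sqrt e"
      unfolding continuous_on_iff by (metis real_sqrt_gt_zero)
    define K where "K = (2 * B / \<delta>)\<^sup>2"
    have "(f t - f x)\<^sup>2 \<le> 1 * e + K * (t - x)\<^sup>2" if t: "t \<in> {0..1}" for t
    proof (cases "dist t x < \<delta>")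
      case True
      then have "\<bar>f t - f x\<bar> \<le> sqrt e" using near[OF t] by (simp add: dist_real_def)
      then have "\<bar>f t - f x\<bar>\<^sup>2 \<le> (sqrt e)\<^sup>2" by (rule power_mono) simp
      moreover have "0 \<le> K * (t - x)\<^sup>2" by (simp add: K_def)
      ultimately show ?thesis using e by simp
    next
      case False
      then have far: "1 \<le> \<bar>t - x\<bar> / \<delta>" using \<delta> by (simp add: dist_real_def)
      have "\<bar>f t - f x\<bar> \<le> 2 * B" using B[OF t] B[OF x] by linarith
      also have "\<dots> \<le> 2 * B * (\<bar>t - x\<bar> / \<delta>)"
        using far mult_left_mono[OF far, of "2 * B"] B[OF x] by simp
      finally have "\<bar>f t - f x\<bar>\<^sup>2 \<le> (2 * B * (\<bar>t - x\<bar> / \<delta>))\<^sup>2" by (rule power_mono) simp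
      also have "\<dots> = K * (t - x)\<^sup>2"
        by (simp add: K_def power_mult_distrib power_divide)
      finally show ?thesis using e by simp
    qed
    then have "A (\<lambda>t. (f t - f x)\<^sup>2) \<le> A (\<lambda>t. 1 * e + K * (t - x)\<^sup>2)"
      using f by (intro mono continuous_intros) auto
    also have "\<dots> = 1 * A (\<lambda>_. e) + K * A (\<lambda>t. (t - x)\<^sup>2)"
      by (rule lincomb) (intro continuous_intros)+
    also have "\<dots> = e" by (simp add: const zero)
    finally show ?thesis using cov_self_le[OF f, of "f x"] by linarith
  qed
  then have "cov f f \<le> 0" by (simp add: field_le_epsilon)
  with cov_self_nonneg[OF f] show ?thesis by simp
qed

lemma cov_self_le_concave_majorant:
  assumes f: "continuous_on {0..1} f" and h: "concave_majorant (modulus_cont f) h"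
    and x: "x \<in> {0..1}"
  shows "cov f f \<le> (h (2 * sqrt (A (\<lambda>t. (t - x)\<^sup>2))) / 2)\<^sup>2"
proof (cases "A (\<lambda>t. (t - x)\<^sup>2) = 0")
  case True
  then show ?thesis using cov_self_eq_0[OF f x] by simp
next
  case False
  define \<sigma> where "\<sigma> = sqrt (A (\<lambda>t. (t - x)\<^sup>2))"
  from False second_moment_nonneg[of x] have \<sigma>: "\<sigma> > 0" and \<sigma>2: "A (\<lambda>t. (t - x)\<^sup>2) = \<sigma>\<^sup>2"
    by (simp_all add: \<sigma>_def)
  obtain p c L where p: "L-lipschitz_on {0..1} p"
    and c: "\<And>u. u \<in> {0..1} \<Longrightarrow> \<bar>f u - p u\<bar> \<le> c" and cL: "c + L * \<sigma> = h (2 * \<sigma>) / 2"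
    by (rule concave_majorant_Lipschitz_approximation[OF f h \<sigma>]) (rule that)
  have contp: "continuous_on {0..1} p" by (rule lipschitz_on_continuous_on[OF p])
  have contd: "continuous_on {0..1} (\<lambda>t. f t - p t)" by (intro continuous_intros f contp)
  have "c \<ge> 0" using c[OF x] by linarith
  moreover have "L * \<sigma> \<ge> 0" using lipschitz_on_nonneg[OF p] \<sigma> by simp
  moreover have "cov (\<lambda>t. f t - p t) (\<lambda>t. f t - p t) \<le> c\<^sup>2"
    by (rule cov_self_le_of_bounded[OF contd c])
  moreover have "cov p p \<le> (L * \<sigma>)\<^sup>2"
    using cov_self_le_of_lipschitz[OF p x] by (simp add: \<sigma>2 power_mult_distrib)
  ultimately have "cov (\<lambda>t. (f t - p t) + p t) (\<lambda>t. (f t - p t) + p t) \<le> (c + L * \<sigma>)\<^sup>2"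
    by (intro cov_self_add_le contd contp)
  then show ?thesis by (simp add: cL flip: \<sigma>_def)
qed

lemma Chebyshev_Gruess_inequality:
  assumes f: "continuous_on {0..1} f" and g: "continuous_on {0..1} g" and x: "x \<in> {0..1}"
  shows "\<bar>cov f g\<bar> \<le> 1 / 4 * concave_modulus f (2 * sqrt (A (\<lambda>t. (t - x)\<^sup>2)))
    * concave_modulus g (2 * sqrt (A (\<lambda>t. (t - x)\<^sup>2)))"
proof -
  let ?s = "2 * sqrt (A (\<lambda>t. (t - x)\<^sup>2))"
  have s: "?s \<ge> 0" using second_moment_nonneg[of x] by simp
  have bound: "cov k k \<le> (concave_modulus k ?s / 2)\<^sup>2 \<and> 0 \<le> concave_modulus k ?s / 2"
    if k: "continuous_on {0..1} k" for k
    using cov_self_le_concave_majorant[OF k concave_majorant_modulus_cont[OF k] x]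
      concave_majorant_modulus_nonneg[OF k concave_majorant_modulus_cont[OF k] s]
    unfolding concave_modulus_def by simp
  have "\<bar>cov f g\<bar> \<le> concave_modulus f ?s / 2 * (concave_modulus g ?s / 2)"
    using bound[OF f] bound[OF g] by (intro abs_cov_le f g) auto
  then show ?thesis by simp
qed

end

section \<open>The Bernstein-Euler-Jacobi operator\<close>

lemma unital_positive_functional_eval: "y \<in> {0..1} \<Longrightarrow> unital_positive_functional (\<lambda>f. f y)"
  by unfold_locales auto

lemma unital_positive_functional_convex_combination:
  assumes "finite I" and A: "\<And>k. k \<in> I \<Longrightarrow> unital_positive_functional (A k)"
    and w: "\<And>k. k \<in> I \<Longrightarrow> 0 \<le> w k" and "sum w I = 1"
  shows "unital_positive_functional (\<lambda>f. \<Sum>k\<in>I. A k f * w k)"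
proof
  show "(\<Sum>k\<in>I. A k (\<lambda>t. f t + g t) * w k) = (\<Sum>k\<in>I. A k f * w k) + (\<Sum>k\<in>I. A k g * w k)"
    if "continuous_on {0..1} f" "continuous_on {0..1} g" for f g
    using unital_positive_functional.add[OF A that]
    by (simp add: distrib_right flip: sum.distrib)
  show "(\<Sum>k\<in>I. A k (\<lambda>t. c * f t) * w k) = c * (\<Sum>k\<in>I. A k f * w k)"
    if "continuous_on {0..1} f" for f c
    using unital_positive_functional.scale[OF A that] by (simp add: sum_distrib_left mult.assoc)
  show "0 \<le> (\<Sum>k\<in>I. A k f * w k)"
    if "continuous_on {0..1} f" "\<And>t. t \<in> {0..1} \<Longrightarrow> 0 \<le> f t" for f
    using unital_positive_functional.nonneg[OF A that] w
    by (intro sum_nonneg mult_nonneg_nonneg) auto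
  show "(\<Sum>k\<in>I. A k (\<lambda>_. 1) * w k) = 1"
    using unital_positive_functional.one[OF A] assms(4) by simp
qed

lemma unital_positive_functional_bernstein_combination:
  assumes "\<And>k. k \<le> n \<Longrightarrow> unital_positive_functional (A k)" and "y \<in> {0..1}"
  shows "unital_positive_functional (\<lambda>f. \<Sum>k\<le>n. A k f * Bernstein n k y)"
  using assms by (intro unital_positive_functional_convex_combination) (auto intro: Bernstein_nonneg)

lemma unital_positive_functional_bernstein_op:
  assumes "n > 0" and "y \<in> {0..1}"
  shows "unital_positive_functional (\<lambda>f. bernstein_op n f y)"
  unfolding bernstein_op_def using assms
  by (intro unital_positive_functional_bernstein_combination unital_positive_functional_eval) auto

lemma continuous_on_bernstein_op: "continuous_on S (bernstein_op n f)"
  unfolding bernstein_op_def Bernstein_def by (intro continuous_intros)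

lemma unital_positive_functional_comp_bernstein_op:
  assumes "unital_positive_functional A" and n: "n > 0"
  shows "unital_positive_functional (\<lambda>f. A (bernstein_op n f))"
proof -
  interpret unital_positive_functional A by fact
  note B = continuous_on_bernstein_op
  show ?thesis
  proof
    fix f g :: "real \<Rightarrow> real" and c :: real
    have "bernstein_op n (\<lambda>t. f t + g t) = (\<lambda>y. bernstein_op n f y + bernstein_op n g y)"
      by (simp add: fun_eq_iff bernstein_op_def distrib_right sum.distrib)
    then show "A (bernstein_op n (\<lambda>t. f t + g t)) = A (bernstein_op n f) + A (bernstein_op n g)"
      using add[OF B B] by simp
    have "bernstein_op n (\<lambda>t. c * f t) = (\<lambda>y. c * bernstein_op n f y)"
      by (simp add: fun_eq_iff bernstein_op_def sum_distrib_left mult.assoc)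
    then show "A (bernstein_op n (\<lambda>t. c * f t)) = c * A (bernstein_op n f)"
      using scale[OF B] by simp
    show "0 \<le> A (bernstein_op n f)"
      if "continuous_on {0..1} f" "\<And>t. t \<in> {0..1} \<Longrightarrow> 0 \<le> f t"
      using unital_positive_functional.nonneg[OF unital_positive_functional_bernstein_op[OF n] that]
      by (intro nonneg B)
    have "bernstein_op n (\<lambda>_. 1) = (\<lambda>_. 1)"
      by (simp add: fun_eq_iff bernstein_op_def)
    then show "A (bernstein_op n (\<lambda>_. 1)) = 1" by (simp add: one)
  qed
qed

text \<open>
  Both exponents exceed \<open>-1\<close> as soon as the two exceptional points are excluded, because
  \<open>r x > 0\<close> for \<open>x > 0\<close> and \<open>r (1 - x) > 0\<close> for \<open>x < 1\<close>.
\<close>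
lemma unital_positive_functional_beta_op:
  assumes r: "r > 0" and a: "a \<ge> -1" and b: "b \<ge> -1" and y: "y \<in> {0..1}"
  shows "unital_positive_functional (\<lambda>f. beta_op r a b f y)"
proof (cases "a = -1 \<and> y = 0 \<or> b = -1 \<and> y = 1")
  case True
  then have "(\<lambda>f. beta_op r a b f y) = (\<lambda>f. f y)"
    by (auto simp: beta_op_def fun_eq_iff)
  then show ?thesis using unital_positive_functional_eval[OF y] by simp
next
  case False
  have ry: "r * y \<ge> 0" "r * (1 - y) \<ge> 0" using r y by auto
  have p: "0 < r * y + a + 1"
  proof (cases "a = -1")
    case True
    with False y have "y > 0" by auto
    with True r show ?thesis by simp
  qed (use a ry in linarith)
  have q: "0 < r * (1 - y) + b + 1"
  proof (cases "b = -1")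
    case True
    with False y have "1 - y > 0" by auto
    with True r show ?thesis by simp
  qed (use b ry in linarith)
  define w where "w = (\<lambda>t. t powr (r * y + a) * (1 - t) powr (r * (1 - y) + b))"
  define I where "I = integral {0..1} w"
  have w: "(w has_integral Beta (r * y + a + 1) (r * (1 - y) + b + 1)) {0..1}"
    using has_integral_Beta_real[OF p q] by (simp add: w_def)
  have I: "I > 0"
    using integral_unique[OF w] p q by (simp add: I_def Beta_def)
  have w_nonneg: "0 \<le> w t" for t by (simp add: w_def)
  have int: "(\<lambda>t. w t * f t) integrable_on {0..1}" if f: "continuous_on {0..1} f" for f
  proof -
    have "w absolutely_integrable_on {0..1}"
      using w w_nonneg by (intro nonnegative_absolutely_integrable_1) auto
    then have "(\<lambda>t. f t * w t) absolutely_integrable_on {0..1}"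
      using f by (intro absolutely_integrable_bounded_measurable_product_real
          continuous_imp_measurable_on_sets_lebesgue compact_imp_bounded compact_continuous_image) auto
    then show ?thesis
      by (simp add: mult.commute set_lebesgue_integral_eq_integral)
  qed
  have op: "beta_op r a b f y = integral {0..1} (\<lambda>t. w t * f t) / I" for f
    using False by (auto simp: beta_op_def w_def I_def)
  show ?thesis
    unfolding op
  proof
    fix f :: "real \<Rightarrow> real" and c :: real
    assume f: "continuous_on {0..1} f"
    show "integral {0..1} (\<lambda>t. w t * (f t + g t)) / I
        = integral {0..1} (\<lambda>t. w t * f t) / I + integral {0..1} (\<lambda>t. w t * g t) / I"
      if g: "continuous_on {0..1} g" for g
      by (simp add: distrib_left integral_add[OF int[OF f] int[OF g]] add_divide_distrib)
    show "integral {0..1} (\<lambda>t. w t * (c * f t)) / I = c * (integral {0..1} (\<lambda>t. w t * f t) / I)"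
      by (simp add: mult.left_commute)
    show "0 \<le> integral {0..1} (\<lambda>t. w t * f t) / I"
      if "\<And>t. t \<in> {0..1} \<Longrightarrow> 0 \<le> f t"
      using that w_nonneg I
      by (intro divide_nonneg_pos integral_nonneg int[OF f] mult_nonneg_nonneg) auto
  next
    show "integral {0..1} (\<lambda>t. w t * 1) / I = 1" using I by (simp add: I_def)
  qed
qed

text \<open>
  The outer Bernstein operator samples its argument at the points \<open>k / m\<close>, so \<open>f \<mapsto> R f x\<close> is a
  convex combination of the functionals \<open>f \<mapsto> beta_op r a b (bernstein_op n f) (k / m)\<close>.
\<close>
lemma unital_positive_functional_bernstein_euler_jacobi:
  assumes "r > 0" and "a \<ge> -1" and "b \<ge> -1" and "n > 0" and "m > 0" and "x \<in> {0..1}"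
  shows "unital_positive_functional (\<lambda>f. bernstein_euler_jacobi m n r a b f x)"
proof -
  have "unital_positive_functional (\<lambda>f. beta_op r a b (bernstein_op n f) (real k / real m))"
    if "k \<le> m" for k
    using assms that
    by (intro unital_positive_functional_comp_bernstein_op unital_positive_functional_beta_op) auto
  from unital_positive_functional_bernstein_combination[OF this \<open>x \<in> {0..1}\<close>]
  show ?thesis
    by (simp add: bernstein_euler_jacobi_def bernstein_op_def[of m])
qed

theorem mainTheorem1:
  fixes r a b x :: real and m n :: nat and f g :: "real \<Rightarrow> real"
  assumes "r > 0" and "a \<ge> -1" and "b \<ge> -1"
    and "n > 1" and "m > 1"
    and "continuous_on {0..1} f" and "continuous_on {0..1} g"
    and "x \<in> {0..1}"
  shows "\<bar>chebyshev_functional (bernstein_euler_jacobi m n r a b) f g x\<bar>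
    \<le> 1 / 4
      * concave_modulus f (2 * sqrt (bernstein_euler_jacobi m n r a b (\<lambda>t. (t - x)\<^sup>2) x))
      * concave_modulus g (2 * sqrt (bernstein_euler_jacobi m n r a b (\<lambda>t. (t - x)\<^sup>2) x))"
proof -
  interpret unital_positive_functional "\<lambda>f. bernstein_euler_jacobi m n r a b f x"
    using assms by (intro unital_positive_functional_bernstein_euler_jacobi) auto
  show ?thesis
    using Chebyshev_Gruess_inequality[OF assms(6-8)]
    by (simp only: cov_def chebyshev_functional_def)
qed

end
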